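(* Let $n\ge2$ be an integer, let $\mathbf d=(d_1,d_2)\in\mathbb{R}^2$ with $d_1\neq d_2$, and let $\frac12<\gamma<1$. Then there exist $c_0=c_0(n,\mathbf d)>0$, $c_{13}=c_{13}(n,\mathbf d,\gamma)>0$ and $Q_0=Q_0(n,\mathbf d,\gamma)$ such that for every $c_8>c_0$, every $Q>Q_0$, and every square $\Pi=I_1\times I_2$ with midpoint $\mathbf d$ and side lengths $\mu_1I_1=\mu_1I_2=c_8Q^{-\gamma}$ which is $\left(\tfrac12,\tfrac12\right)$-special, we have $$\#\mathcal{A}_n^2(Q,\Pi)>c_{13}\,Q^{n+1}\mu_2\Pi.$$
   Context: Height: $H(P)=\max_j|a_j|$ for $P(t)=\sum a_jt^j\in\mathbb{Z}[t]$; $\mathcal{P}_m(Q)=\{P\in\mathbb{Z}[t]:\deg P\le m,\ H(P)\le Q\}$. A point $\boldsymbol\alpha=(\alpha_1,\alpha_2)$ is an algebraic point if $\alpha_1,\alpha_2$ are roots of the same irreducible polynomial in $\mathbb{Z}[t]$; its minimal polynomial is the polynomial of smallest degree ($\ge2$) with coprime integer coefficients vanishing at $\alpha_1,\alpha_2$, and degree/height of $\boldsymbol\alpha$ are those of it. $\mathcal{A}_n^2(Q)$ is the set of algebraic points of degree $\le n$ and height $\le Q$, and $\mathcal{A}_n^2(Q,\Pi)=\mathcal{A}_n^2(Q)\cap\Pi$. $\mu_1,\mu_2$ are Lebesgue measures. Special squares: let $\Pi$ be a square with midpoint $\mathbf d$, $d_1\ne d_2$, sides $c_8Q^{-\gamma}$,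 $\frac12<\gamma<1$. Put $L=\left\lfloor\frac{3-2\gamma}{1-\gamma}\right\rfloor$, $\lambda_l=1-\frac{(l-1)(1-\gamma)}{2}$ for $1\le l\le L+1$, $\lambda_{L+2}=\gamma-\frac12$, $\lambda_l=0$ for $l\ge L+3$; $h=\sqrt{\tfrac32(|d_1|+|d_2|)\max(1,3|d_1|,3|d_2|)^{4}}$ and $\delta=2^{-L-17}h^{-2}(d_1-d_2)^2$. For $v_1,v_2>0$ with $v_1+v_2=1$ and an integer $l\ge1$, $\Pi$ satisfies the $(l,v_1,v_2)$-condition if the number of polynomials $P(t)=a_2t^2+a_1t+a_0\in\mathcal{P}_2(Q)$ for which there is a point $\mathbf x_0=(x_{0,1},x_{0,2})\in\Pi$ with $|P(x_{0,i})|<hQ^{-v_i}$ ($i=1,2$) and $\delta Q^{\lambda_{l+1}}\le|a_2|<\delta Q^{\lambda_l}$ is at most $\delta^3 2^{l+3}Q^{1+2\lambda_{l+1}}\mu_2\Pi$. $\Pi$ is $(v_1,v_2)$-special if it satisfies the $(l,v_1,v_2)$-condition for all $1\le l\le L+2$.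
   Formalization: Q_0 may here also depend on c_8: with Q_0 depending only on n, d, γ the claim is false, since for fixed Q and c_8→∞ every square becomes special while #A_n^2(Q) stays bounded and c_13 Q^{n+1} μ_2Π tends to infinity. *)

theory Defs
  imports "HOL-Analysis.Analysis" "HOL-Computational_Algebra.Computational_Algebra"
begin

definition height :: "int poly \<Rightarrow> int" where
  "height P = Max ((\<lambda>j. \<bar>coeff P j\<bar>) ` {..degree P})"

definition polys_bounded :: "nat \<Rightarrow> real \<Rightarrow> int poly set" where
  "polys_bounded m Q = {P. degree P \<le> m \<and> real_of_int (height P) \<le> Q}"

definition real_eval :: "int poly \<Rightarrow> real \<Rightarrow> real" where
  "real_eval P x = poly (map_poly real_of_int P) x"

definition vanishes_at :: "int poly \<Rightarrow> real \<times> real \<Rightarrow> bool" where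
  "vanishes_at P \<alpha> \<longleftrightarrow> real_eval P (fst \<alpha>) = 0 \<and> real_eval P (snd \<alpha>) = 0"

definition algebraic_point :: "real \<times> real \<Rightarrow> bool" where
  "algebraic_point \<alpha> \<longleftrightarrow> (\<exists>P. irreducible P \<and> vanishes_at P \<alpha>)"

text \<open>For an algebraic point the minimal polynomial is unique up to sign, so its degree and
  height do not depend on the choice. Because of the bound \<open>degree P \<ge> 2\<close>, the points \<open>(q, q)\<close>
  with \<open>q\<close> rational have no minimal polynomial.\<close>

definition minimal_polynomial :: "int poly \<Rightarrow> real \<times> real \<Rightarrow> bool" where
  "minimal_polynomial P \<alpha> \<longleftrightarrow>
     content P = 1 \<and> degree P \<ge> 2 \<and> vanishes_at P \<alpha> \<and>
     (\<forall>R. content R = 1 \<longrightarrow> vanishes_at R \<alpha> \<longrightarrow> degree P \<le> degree R)"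

definition algebraic_points :: "nat \<Rightarrow> real \<Rightarrow> (real \<times> real) set" where
  "algebraic_points n Q =
     {\<alpha>. algebraic_point \<alpha> \<and>
        (\<exists>P. minimal_polynomial P \<alpha> \<and> degree P \<le> n \<and> real_of_int (height P) \<le> Q)}"

text \<open>The interval may be open, closed or half-open.\<close>

definition interval_with :: "real \<Rightarrow> real \<Rightarrow> real set \<Rightarrow> bool" where
  "interval_with m s I \<longleftrightarrow>
     is_interval I \<and> bounded I \<and> I \<noteq> {} \<and> (Inf I + Sup I) / 2 = m \<and> measure lebesgue I = s"

definition L_of :: "real \<Rightarrow> nat" where
  "L_of \<gamma> = nat \<lfloor>(3 - 2 * \<gamma>) / (1 - \<gamma>)\<rfloor>"

definition lam :: "real \<Rightarrow> nat \<Rightarrow> real" where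
  "lam \<gamma> l =
     (if l \<le> L_of \<gamma> + 1 then 1 - (real l - 1) * (1 - \<gamma>) / 2
      else if l = L_of \<gamma> + 2 then \<gamma> - 1 / 2
      else 0)"

definition h_of :: "real \<times> real \<Rightarrow> real" where
  "h_of d = sqrt (3 / 2 * (\<bar>fst d\<bar> + \<bar>snd d\<bar>) * (Max {1, 3 * \<bar>fst d\<bar>, 3 * \<bar>snd d\<bar>}) ^ 4)"

definition delta_of :: "real \<times> real \<Rightarrow> real \<Rightarrow> real" where
  "delta_of d \<gamma> = (fst d - snd d)\<^sup>2 / (2 ^ (L_of \<gamma> + 17) * (h_of d)\<^sup>2)"

definition special_condition ::
  "real \<times> real \<Rightarrow> real \<Rightarrow> real \<Rightarrow> nat \<Rightarrow> real \<Rightarrow> real \<Rightarrow> (real \<times> real) set \<Rightarrow> bool" where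
  "special_condition d \<gamma> Q l v1 v2 S \<longleftrightarrow>
     real (card {P \<in> polys_bounded 2 Q.
        (\<exists>x\<in>S. \<bar>real_eval P (fst x)\<bar> < h_of d * Q powr (- v1) \<and>
               \<bar>real_eval P (snd x)\<bar> < h_of d * Q powr (- v2)) \<and>
        delta_of d \<gamma> * Q powr (lam \<gamma> (l + 1)) \<le> real_of_int \<bar>coeff P 2\<bar> \<and>
        real_of_int \<bar>coeff P 2\<bar> < delta_of d \<gamma> * Q powr (lam \<gamma> l)})
     \<le> (delta_of d \<gamma>) ^ 3 * 2 ^ (l + 3) * Q powr (1 + 2 * lam \<gamma> (l + 1)) * measure lebesgue S"

definition special ::
  "real \<times> real \<Rightarrow> real \<Rightarrow> real \<Rightarrow> real \<Rightarrow> real \<Rightarrow> (real \<times> real) set \<Rightarrow> bool" where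
  "special d \<gamma> Q v1 v2 S \<longleftrightarrow> (\<forall>l\<in>{1..L_of \<gamma> + 2}. special_condition d \<gamma> Q l v1 v2 S)"

end

theory Submission
  imports Defs "HOL-Real_Asymp.Real_Asymp"
begin

text \<open>
  Since \<open>\<gamma> < 1\<close>, the polynomials counted contain large lattice boxes. Write
  \<open>P(x) = l\<^sub>0 + l\<^sub>1 x + (x - d\<^sub>1)(x - d\<^sub>2) \<Sum>\<^sub>j a\<^sub>j g\<^sub>j(x)\<close> with \<open>g\<^sub>2 = 1\<close>. Choosing \<open>a\<^sub>2, \<dots>, a\<^sub>n\<close> of
  order \<open>Q\<close> with \<open>a\<^sub>2\<close> dominant, and then \<open>a\<^sub>0, a\<^sub>1\<close> in intervals of length of order
  \<open>c\<^sub>8 Q\<^bsup>1-\<gamma>\<^esup>\<close> around the values annihilating \<open>l\<^sub>0, l\<^sub>1\<close>, forces a sign change of \<open>P\<close> within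
  \<open>c\<^sub>8 Q\<^bsup>-\<gamma>\<^esup> / 4\<close> of each \<open>d\<^sub>i\<close>. Congruences modulo 4 make \<open>P\<close> an Eisenstein polynomial at 2, and for
  at least half of the pairs \<open>(a\<^sub>0, a\<^sub>1)\<close> it is primitive: a prime dividing all coefficients divides
  \<open>a\<^sub>n\<close>, which has only \<open>O(log Q)\<close> prime factors. Such polynomials are determined by any of their
  roots, so distinct polynomials give distinct points.
\<close>

section \<open>Eisenstein's criterion and common roots of irreducible integer polynomials\<close>

text \<open>In a factorization exactly one constant coefficient, say that of A, is divisible by p.
  Let i be the first index at which A has a coefficient not divisible by p. Then coefficient i of P
  = A B is congruent to \<open>coeff A i * coeff B 0\<close> modulo p, hence not divisible by p, so
  i is at least the degree of P. This makes B constant, and primitivity of P makes that constant a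
  unit of the integers.\<close>

lemma eisenstein_criterion:
  fixes P :: "int poly"
  assumes p: "prime p" and lead: "\<not> p dvd lead_coeff P"
    and low: "\<And>i. i < degree P \<Longrightarrow> p dvd coeff P i"
    and const: "\<not> p\<^sup>2 dvd coeff P 0"
    and content: "content P = 1" and deg: "degree P > 0"
  shows "irreducible P"
proof -
  have unit: "is_unit B"
    if AB: "P = A * B" and A0: "p dvd coeff A 0" for A B
  proof -
    have nz: "A \<noteq> 0" "B \<noteq> 0" using AB deg by auto
    have cP0: "coeff P 0 = coeff A 0 * coeff B 0" using AB by (simp add: coeff_mult)
    have B0: "\<not> p dvd coeff B 0"
      using A0 const cP0 by (auto simp: power2_eq_square intro: mult_dvd_mono)
    have "\<exists>i. \<not> p dvd coeff A i"
      using lead AB by (metis dvd_mult2 lead_coeff_mult)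
    define i where "i = (LEAST i. \<not> p dvd coeff A i)"
    have Ai: "\<not> p dvd coeff A i" unfolding i_def using \<open>\<exists>i. _\<close> by (rule LeastI_ex)
    have less: "p dvd coeff A j" if "j < i" for j using that not_less_Least i_def by blast
    have "coeff P i = (\<Sum>j\<le>i. coeff A j * coeff B (i - j))" using AB by (simp add: coeff_mult)
    also have "\<dots> = (\<Sum>j<i. coeff A j * coeff B (i - j)) + coeff A i * coeff B 0"
      by (simp add: lessThan_Suc_atMost[symmetric])
    finally have *: "coeff P i = \<dots>" .
    have "p dvd (\<Sum>j<i. coeff A j * coeff B (i - j))"
      by (rule dvd_sum) (use less in auto)
    moreover have "\<not> p dvd coeff A i * coeff B 0"
      using p Ai B0 by (auto simp: prime_dvd_mult_iff)
    ultimately have "\<not> p dvd coeff P i" using * by (metis dvd_add_right_iff)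
    then have "degree P \<le> i" using low by (meson not_less)
    also have "i \<le> degree A" using Ai by (intro le_degree) auto
    finally have "degree B = 0" using AB nz by (simp add: degree_mult_eq)
    then obtain k where k: "B = [:k:]" by (auto elim: degree_eq_zeroE)
    have "content P = normalize k * content A" using AB k by (simp add: mult.commute)
    then have "is_unit k" using content by (metis dvd_normalize_iff dvd_triv_left normalize_dvd_iff)
    then show ?thesis using k by (simp add: is_unit_const_poly_iff)
  qed
  show ?thesis
  proof (rule irreducibleI)
    show "P \<noteq> 0" "\<not> is_unit P" using deg by (auto simp: is_unit_poly_iff)
    fix A B assume AB: "P = A * B"
    have "p dvd coeff A 0 * coeff B 0" using low[OF deg] AB by (simp add: coeff_mult)
    then have "p dvd coeff A 0 \<or> p dvd coeff B 0" using p by (simp add: prime_dvd_mult_iff)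
    then show "is_unit A \<or> is_unit B"
      using unit[of A B] unit[of B A] AB by (auto simp: mult.commute)
  qed
qed

lemma real_eval_0 [simp]: "real_eval 0 x = 0"
  by (simp add: real_eval_def)

lemma real_eval_pCons [simp]: "real_eval (pCons c P) x = of_int c + x * real_eval P x"
  by (simp add: real_eval_def map_poly_pCons)

lemma real_eval_add [simp]: "real_eval (P + R) x = real_eval P x + real_eval R x"
  by (induction P R rule: poly_induct2) (simp_all add: algebra_simps)

lemma real_eval_smult [simp]: "real_eval (smult c P) x = of_int c * real_eval P x"
  by (induction P) (simp_all add: algebra_simps)

lemma real_eval_mult [simp]: "real_eval (P * R) x = real_eval P x * real_eval R x"
  by (induction P) (simp_all add: algebra_simps)

text \<open>Pseudo-division keeps the argument inside Z[t], where P is prime because Z[t] is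
  factorial. First, P has least degree among the nonzero polynomials vanishing at x: pseudo-dividing
  P by one of least degree, M, leaves no remainder, and primality gives that P divides M.
  Pseudo-dividing R by P then leaves no remainder either, and the non-constant P cannot divide the
  integer factor c.\<close>

lemma irreducible_dvd_if_common_root:
  assumes irr: "irreducible P" and P: "real_eval P x = 0" and R: "real_eval R x = 0"
  shows "P dvd R"
proof -
  have prime: "prime_elem P" using irr by (rule irreducible_imp_prime_elem)
  have P0: "P \<noteq> 0" using irr by auto
  have const: "S = 0" if "degree S = 0" "real_eval S x = 0" for S
    using that by (auto elim!: degree_eq_zeroE)
  have degP: "degree P > 0" using const P P0 by blast
  let ?V = "\<lambda>S. S \<noteq> 0 \<and> real_eval S x = 0"
  have min: "degree P \<le> degree S" if S: "?V S" for S
  proof -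
    define M where "M = arg_min degree ?V"
    have M: "?V M" unfolding M_def by (rule arg_min_natI[of ?V S, OF S])
    have M_min: "degree M \<le> degree S" if "?V S" for S
      unfolding M_def by (rule arg_min_nat_le[of ?V S, OF that])
    obtain q r where qr: "pseudo_divmod P M = (q, r)" by force
    define c where "c = lead_coeff M ^ (Suc (degree P) - degree M)"
    have c: "c \<noteq> 0" using M by (simp add: c_def)
    have div: "smult c P = M * q + r" and r: "r = 0 \<or> degree r < degree M"
      using pseudo_divmod[OF _ qr] M by (auto simp: c_def)
    have "real_eval r x = 0" using arg_cong[OF div, of "\<lambda>p. real_eval p x"] P M by simp
    then have "r = 0" using r M_min[of r] by (meson not_le)
    then have eq: "smult c P = M * q" using div by simp
    then have "P dvd M * q" by (metis dvd_refl dvd_smult)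
    then have "P dvd M \<or> P dvd q" using prime prime_elem_dvd_mult_iff by blast
    \<comment> \<open>Otherwise P cancels and the constant c is a multiple of M; evaluating at the
      root x of M gives c = 0.\<close>
    moreover have "\<not> P dvd q"
    proof
      assume "P dvd q"
      then obtain s where "q = P * s" ..
      then have "P * [:c:] = P * (M * s)" using eq by (simp add: algebra_simps)
      then have "[:c:] = M * s" using P0 mult_left_cancel by blast
      from arg_cong[OF this, of "\<lambda>p. real_eval p x"] show False using M c by simp
    qed
    ultimately have "P dvd M" by blast
    then have "degree P \<le> degree M" using M by (simp add: dvd_imp_degree_le)
    with M_min[OF S] show ?thesis by simp
  qed
  obtain q r where qr: "pseudo_divmod R P = (q, r)" by force
  define c where "c = lead_coeff P ^ (Suc (degree R) - degree P)"
  have c: "c \<noteq> 0" using P0 by (simp add: c_def)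
  have div: "smult c R = P * q + r" and r: "r = 0 \<or> degree r < degree P"
    using pseudo_divmod[OF P0 qr] by (auto simp: c_def)
  have "real_eval r x = 0" using arg_cong[OF div, of "\<lambda>p. real_eval p x"] P R by simp
  then have "r = 0" using r min[of r] by (meson not_le)
  then have "P dvd [:c:] * R" using div by simp
  then have "P dvd [:c:] \<or> P dvd R" using prime prime_elem_dvd_mult_iff by blast
  moreover have "\<not> P dvd [:c:]" using dvd_imp_degree_le[of P "[:c:]"] c degP by auto
  ultimately show ?thesis by blast
qed

lemma irreducible_minimal_polynomial:
  assumes "irreducible P" "content P = 1" "degree P \<ge> 2" "vanishes_at P \<alpha>"
  shows "minimal_polynomial P \<alpha>"
  unfolding minimal_polynomial_def
proof (intro conjI assms allI impI)
  fix R :: "int poly" assume "content R = 1" "vanishes_at R \<alpha>"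
  then have "P dvd R" "R \<noteq> 0"
    using irreducible_dvd_if_common_root assms(1,4) by (auto simp: vanishes_at_def)
  then show "degree P \<le> degree R" by (rule dvd_imp_degree_le)
qed

text \<open>The quotient of R by P is a unit of Z[t], hence 1 or -1, and an index at which both
  coefficients are positive excludes -1. This is what turns distinct polynomials into distinct
  algebraic points.\<close>

lemma irreducible_eq_if_common_root:
  fixes P R :: "int poly"
  assumes "irreducible P" "irreducible R" "real_eval P x = 0" "real_eval R x = 0"
    and pos: "coeff P i > 0" "coeff R i > 0"
  shows "P = R"
proof -
  have "P dvd R" "R dvd P" using assms irreducible_dvd_if_common_root by blast+
  then obtain u where u: "R = P * u" "is_unit u"
    using assms by (metis dvd_def irreducibleD irreducible_def)
  then obtain k where k: "u = [:k:]" "is_unit k" by (auto simp: is_unit_poly_iff)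
  then have "k = 1 \<or> k = -1" by auto
  then show ?thesis using u k pos by auto
qed

section \<open>Finiteness of the sets being counted\<close>

lemma finite_polys_bounded: "finite (polys_bounded n Q)"
proof -
  have "polys_bounded n Q \<subseteq> Poly ` {xs. set xs \<subseteq> {-\<lfloor>Q\<rfloor>..\<lfloor>Q\<rfloor>} \<and> length xs \<le> Suc n}"
  proof
    fix P assume P: "P \<in> polys_bounded n Q"
    have "\<bar>coeff P i\<bar> \<le> \<lfloor>Q\<rfloor>" if "i \<le> degree P" for i
    proof -
      have "\<bar>coeff P i\<bar> \<le> height P" unfolding height_def using that by (intro Max_ge) auto
      also have "height P \<le> \<lfloor>Q\<rfloor>" using P by (simp add: polys_bounded_def le_floor_iff)
      finally show ?thesis .
    qed
    then have "set (coeffs P) \<subseteq> {-\<lfloor>Q\<rfloor>..\<lfloor>Q\<rfloor>}"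
      by (auto simp: coeffs_def abs_le_iff less_Suc_eq_le minus_le_iff less_imp_le)
    moreover have "length (coeffs P) \<le> Suc n"
      using P by (simp add: polys_bounded_def length_coeffs coeffs_def)
    ultimately show "P \<in> Poly ` {xs. set xs \<subseteq> {-\<lfloor>Q\<rfloor>..\<lfloor>Q\<rfloor>} \<and> length xs \<le> Suc n}"
      by (intro image_eqI[where x = "coeffs P"]) auto
  qed
  then show ?thesis by (rule finite_subset) (intro finite_imageI finite_lists_length_le, simp)
qed

text \<open>Each of the finitely many nonzero polynomials has finitely many roots. Since
  \<open>card\<close> is 0 on infinite sets, finiteness must be known before any lower bound through
  injections or inclusions.\<close>

lemma finite_algebraic_points: "finite (algebraic_points n Q)"
proof -
  let ?Z = "\<lambda>P. {x. real_eval P x = 0}"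
  have "algebraic_points n Q \<subseteq> (\<Union>P\<in>polys_bounded n Q - {0}. ?Z P \<times> ?Z P)"
    by (auto simp: algebraic_points_def polys_bounded_def minimal_polynomial_def vanishes_at_def)
  moreover have "finite (?Z P)" if "P \<noteq> 0" for P
    unfolding real_eval_def by (rule poly_roots_finite) (use that in \<open>simp add: map_poly_eq_0_iff\<close>)
  ultimately show ?thesis
    by (elim finite_subset) (auto intro!: finite_UN_I finite_cartesian_product simp: finite_polys_bounded)
qed

section \<open>Counting pairs in two progressions without a common prime factor with a given odd
  number\<close>

text \<open>On a single residue class modulo p the map to \<open>x div p\<close> is
  injective.\<close>

lemma card_le_if_cong:
  fixes p T :: nat and X :: "nat set"
  assumes p: "p > 0" and sub: "X \<subseteq> {..<T}" and cong: "\<And>x y. x \<in> X \<Longrightarrow> y \<in> X \<Longrightarrow> x mod p = y mod p"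
  shows "real (card X) \<le> real T / real p + 1"
proof -
  have fin: "finite X" using sub finite_subset by blast
  have inj: "inj_on (\<lambda>x. x div p) X"
    by (rule inj_onI) (metis cong div_mult_mod_eq)
  have "(\<lambda>x. x div p) ` X \<subseteq> {..T div p}"
    using sub by (auto intro!: div_le_mono)
  then have "card X \<le> card {..T div p}" by (metis card_image card_mono finite_atMost inj)
  then have "real (card X) \<le> real (T div p) + 1" by simp
  also have "real (T div p) \<le> real T / real p" by (rule of_nat_div_le_of_nat)
  finally show ?thesis by simp
qed

lemma card_dvd_affine_le:
  fixes p :: nat and u m :: int
  assumes p: "prime p" and m: "\<not> int p dvd m"
  shows "real (card {x \<in> {..<T}. int p dvd m * int x + u}) \<le> real T / real p + 1"
proof (rule card_le_if_cong)
  show "p > 0" using p by (simp add: prime_gt_0_nat)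
  fix x y assume "x \<in> {x \<in> {..<T}. int p dvd m * int x + u}" "y \<in> {x \<in> {..<T}. int p dvd m * int x + u}"
  then have "int p dvd (m * int x + u) - (m * int y + u)" by (intro dvd_diff) auto
  then have "int p dvd m * (int x - int y)" by (simp add: algebra_simps)
  then have "int p dvd int x - int y" using p m by (simp add: prime_dvd_mult_iff)
  then show "x mod p = y mod p" by (metis mod_eq_dvd_iff of_nat_eq_iff zmod_int)
qed auto

text \<open>The term with p = 2j + 1 is at most 1/(4j(j+1)), which telescopes. The value 1/4 is
  small enough to leave half of all pairs in the sieve below.\<close>

lemma sum_inverse_squares_odd_le:
  fixes A :: "nat set"
  assumes fin: "finite A" and odd: "\<And>p. p \<in> A \<Longrightarrow> odd p \<and> p \<ge> 3"
  shows "(\<Sum>p\<in>A. 1 / (real p)\<^sup>2) \<le> 1 / 4"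
proof -
  define k where "k = Suc (Max (insert 0 A))"
  have tele: "(\<Sum>j\<in>{1..<Suc m}. 1 / (real (2 * j + 1))\<^sup>2) \<le> 1 / 4 - 1 / (4 * (real m + 1))" for m
  proof (induction m)
    case (Suc m)
    have "1 / (real (2 * Suc m + 1))\<^sup>2 \<le> 1 / (4 * (real m + 1)) - 1 / (4 * (real (Suc m) + 1))"
      by (simp add: divide_simps) (simp add: power2_eq_square algebra_simps)
    with Suc show ?case by simp
  qed simp
  have "(\<Sum>p\<in>A. 1 / (real p)\<^sup>2) \<le> (\<Sum>p\<in>(\<lambda>j. 2 * j + 1) ` {1..<Suc k}. 1 / (real p)\<^sup>2)"
  proof (rule sum_mono2)
    show "A \<subseteq> (\<lambda>j. 2 * j + 1) ` {1..<Suc k}"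
    proof
      fix p assume p: "p \<in> A"
      then have "p \<le> k" unfolding k_def using fin by (simp add: le_SucI)
      with odd[OF p] show "p \<in> (\<lambda>j. 2 * j + 1) ` {1..<Suc k}"
        by (intro image_eqI[where x = "p div 2"]) auto
    qed
  qed auto
  also have "\<dots> = (\<Sum>j\<in>{1..<Suc k}. 1 / (real (2 * j + 1))\<^sup>2)"
    by (subst sum.reindex) (auto simp: inj_on_def)
  also have "\<dots> \<le> 1 / 4" using tele[of k] by (smt (verit) divide_nonneg_nonneg of_nat_0_le_iff)
  finally show ?thesis .
qed

lemma two_power_card_prime_factors_le:
  fixes a :: nat
  assumes "a > 0"
  shows "2 ^ card (prime_factors a) \<le> a"
proof -
  have "2 ^ card (prime_factors a) = (\<Prod>p\<in>prime_factors a. (2::nat))" by simp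
  also have "\<dots> \<le> (\<Prod>p\<in>prime_factors a. p ^ multiplicity p a)"
  proof (rule prod_mono)
    fix p assume p: "p \<in> prime_factors a"
    then have "2 \<le> p" by (auto dest: in_prime_factors_imp_prime simp: prime_ge_2_nat)
    also have "p \<le> p ^ multiplicity p a"
      using p by (intro self_le_power) (auto simp: prime_factors_multiplicity dest: prime_ge_1_nat)
    finally show "0 \<le> (2::nat) \<and> 2 \<le> p ^ multiplicity p a" by simp
  qed
  also have "\<dots> = a" using assms prime_factorization_nat[of a] by simp
  finally show ?thesis .
qed

text \<open>Union bound over the primes p dividing a. They are odd, so 4 is invertible modulo p and
  at most (T/p + 1)^2 pairs are bad for p; this is at most T^2/p^2 + 3T. The first terms sum to at
  most T^2/4. The number of primes is at most log2 a, hence at most T/12, so the second terms sum to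
  at most T^2/4 as well.\<close>

lemma card_coprime_pairs_ge:
  fixes a T :: nat and u v :: int and Q :: real
  assumes a: "odd a" and aQ: "real a \<le> Q" and T: "T > 0" and log: "12 * log 2 Q \<le> real T"
  defines "G \<equiv> {(x, y) \<in> {..<T} \<times> {..<T}. \<forall>p. prime p \<longrightarrow>
      \<not> (p dvd a \<and> int p dvd 4 * int x + u \<and> int p dvd 4 * int y + v)}"
  shows "real (card G) \<ge> (real T)\<^sup>2 / 2"
proof -
  have a0: "a > 0" using a by (simp add: odd_pos)
  let ?X = "\<lambda>u p. {x \<in> {..<T}. int p dvd 4 * int x + u}"
  let ?B = "\<Union>p\<in>prime_factors a. ?X u p \<times> ?X v p"
  have fac: "odd p \<and> p \<ge> 3 \<and> prime p" if "p \<in> prime_factors a" for p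
  proof -
    have p: "prime p" "p dvd a" using that by auto
    then have "odd p" using a by (meson dvd_trans)
    then show ?thesis using p prime_ge_2_nat[of p] by (cases "p = 2") auto
  qed
  have X: "real (card (?X w p)) \<le> real T / real p + 1" if "p \<in> prime_factors a" for w p
  proof (rule card_dvd_affine_le)
    show "prime p" using fac that by blast
    show "\<not> int p dvd 4"
    proof
      assume "int p dvd 4"
      then have "p dvd 2 ^ 2" by (metis int_dvd_int_iff of_nat_numeral power2_eq_square numeral_times_numeral num_double)
      then have "p dvd 2" using fac[OF that] prime_dvd_power by blast
      then show False using fac[OF that] by (auto dest: dvd_imp_le)
    qed
  qed
  have "real (card (prime_factors a)) \<le> log 2 Q"
  proof -
    have "2 powr real (card (prime_factors a)) = real (2 ^ card (prime_factors a))"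
      by (simp add: powr_realpow)
    also have "\<dots> \<le> real a"
      using two_power_card_prime_factors_le[OF a0] of_nat_le_iff by blast
    also note aQ
    finally have "2 powr real (card (prime_factors a)) \<le> Q" .
    then show ?thesis using aQ a0 by (subst le_log_iff) auto
  qed
  then have om: "12 * real (card (prime_factors a)) \<le> real T" using log by simp
  have "real (card ?B) \<le> (\<Sum>p\<in>prime_factors a. real (card (?X u p \<times> ?X v p)))"
    unfolding of_nat_sum[symmetric] of_nat_le_iff by (rule card_UN_le) simp
  also have "\<dots> \<le> (\<Sum>p\<in>prime_factors a. (real T)\<^sup>2 * (1 / (real p)\<^sup>2) + 3 * real T)"
  proof (rule sum_mono)
    fix p assume p: "p \<in> prime_factors a"
    have p3: "real p \<ge> 3" using fac[OF p] by simp
    have "real (card (?X u p \<times> ?X v p)) \<le> (real T / real p + 1) * (real T / real p + 1)"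
      unfolding card_cartesian_product of_nat_mult using X[OF p] by (intro mult_mono) auto
    also have "\<dots> = (real T)\<^sup>2 * (1 / (real p)\<^sup>2) + 2 * (real T / real p) + 1"
      by (simp add: power2_eq_square algebra_simps)
    also have "real T / real p \<le> real T / 1" using p3 by (intro divide_left_mono) auto
    finally show "real (card (?X u p \<times> ?X v p)) \<le> (real T)\<^sup>2 * (1 / (real p)\<^sup>2) + 3 * real T"
      using T by simp
  qed
  also have "\<dots> = (real T)\<^sup>2 * (\<Sum>p\<in>prime_factors a. 1 / (real p)\<^sup>2) + real (card (prime_factors a)) * (3 * real T)"
    by (simp add: sum.distrib sum_distrib_left)
  also have "\<dots> \<le> (real T)\<^sup>2 * (1 / 4) + (real T / 12) * (3 * real T)"
    using om fac by (intro add_mono mult_left_mono mult_right_mono sum_inverse_squares_odd_le) auto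
  also have "\<dots> = (real T)\<^sup>2 / 2" by (simp add: power2_eq_square)
  finally have B: "real (card ?B) \<le> (real T)\<^sup>2 / 2" .
  have "{..<T} \<times> {..<T} \<subseteq> G \<union> ?B"
    using a0 by (auto simp: G_def prime_factors_dvd)
  then have "card ({..<T} \<times> {..<T}) \<le> card (G \<union> ?B)"
    using finite_subset[of G "{..<T} \<times> {..<T}"] by (intro card_mono) (auto simp: G_def)
  also have "\<dots> \<le> card G + card ?B" by (rule card_Un_le)
  finally have "(real T)\<^sup>2 \<le> real (card G) + real (card ?B)"
    by (simp add: power2_eq_square flip: of_nat_mult of_nat_add)
  with B show ?thesis by simp
qed

section \<open>Intervals and squares with prescribed midpoint and side\<close>

text \<open>The interval lies between the open and the closed interval with endpoints
  \<open>Inf I\<close> and \<open>Sup I\<close>. Both have the same measure, so s is the distance of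
  these endpoints, whichever of them belong to I.\<close>

lemma interval_with_bounds:
  assumes I: "interval_with m s I"
  shows "{m - s / 2<..<m + s / 2} \<subseteq> I" and "I \<subseteq> {m - s / 2..m + s / 2}"
proof -
  define a b where "a = Inf I" and "b = Sup I"
  have I': "is_interval I" "bounded I" "I \<noteq> {}" "a + b = 2 * m" "measure lebesgue I = s"
    using I by (auto simp: interval_with_def a_def b_def field_simps)
  have bdd: "bdd_above I" "bdd_below I"
    using I'(2) by (auto intro: bounded_imp_bdd_above bounded_imp_bdd_below)
  have up: "I \<subseteq> {a..b}" using bdd by (auto simp: a_def b_def intro: cInf_lower cSup_upper)
  then have ab: "a \<le> b" using I'(3) by force
  have low: "{a<..<b} \<subseteq> I"
  proof
    fix x assume "x \<in> {a<..<b}"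
    then obtain y z where "y \<in> I" "y < x" "z \<in> I" "x < z"
      using I'(3) bdd by (auto simp: a_def b_def cInf_less_iff less_cSup_iff)
    then show "x \<in> I" using I'(1) unfolding is_interval_1 by (meson less_imp_le)
  qed
  have meas: "I \<in> lmeasurable" using I' is_interval_convex measurable_convex by blast
  have "b - a = measure lebesgue {a<..<b}" using ab by simp
  also have "\<dots> \<le> s" unfolding I'(5)[symmetric] using low meas by (intro measure_mono_fmeasurable) auto
  finally have "b - a \<le> s" .
  moreover have "s \<le> measure lebesgue {a..b}"
    unfolding I'(5)[symmetric] using up meas by (intro measure_mono_fmeasurable) auto
  ultimately have "b - a = s" using ab by simp
  then have "a = m - s / 2" "b = m + s / 2" using I'(4) by (auto simp: field_simps)
  then show "{m - s / 2<..<m + s / 2} \<subseteq> I" "I \<subseteq> {m - s / 2..m + s / 2}" using up low by auto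
qed

lemma measure_Times_interval_with_le:
  assumes "interval_with m s I" "interval_with m' s J" "s \<ge> 0"
  shows "measure lebesgue (I \<times> J) \<le> s\<^sup>2"
proof -
  let ?C = "cbox (m - s / 2, m' - s / 2) (m + s / 2, m' + s / 2)"
  have sub: "I \<times> J \<subseteq> ?C"
    using interval_with_bounds(2)[OF assms(1)] interval_with_bounds(2)[OF assms(2)]
    unfolding cbox_Pair_eq by auto
  have "convex (I \<times> J)" "bounded (I \<times> J)"
    using assms by (auto simp: interval_with_def is_interval_convex intro: convex_Times bounded_Times)
  then have "I \<times> J \<in> lmeasurable" by (rule measurable_convex)
  then have "measure lebesgue (I \<times> J) \<le> measure lebesgue ?C"
    using sub by (intro measure_mono_fmeasurable) auto
  also have "\<dots> = s\<^sup>2"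
    using assms(3) content_Pair[of "m - s / 2" "m' - s / 2" "m + s / 2" "m' + s / 2"]
    by (simp add: power2_eq_square)
  finally show ?thesis .
qed

section \<open>Linear interpolation at two nodes and roots close to them\<close>

text \<open>Induction on j: multiply by x and replace the resulting square by x^2 = (d1 + d2) x - d1
  d2 + (x - d1)(x - d2). The case j = 2 is singled out because the quadratic coefficient is going to
  dominate and its remainder must be known exactly.\<close>

lemma linear_interpolation_remainder:
  fixes d1 d2 :: real
  shows "\<exists>\<alpha> \<beta> g. continuous_on UNIV g \<and> (j = 2 \<longrightarrow> (\<forall>x. g x = 1)) \<and>
    (\<forall>x. x ^ j = \<alpha> * x + \<beta> + (x - d1) * (x - d2) * g x)"
proof (cases "j = 2")
  case True
  then show ?thesis
    by (intro exI[of _ "d1 + d2"] exI[of _ "- d1 * d2"] exI[of _ "\<lambda>_. 1"])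
      (auto simp: power2_eq_square algebra_simps)
next
  case False
  have "\<exists>\<alpha> \<beta> g. continuous_on UNIV g \<and>
    (\<forall>x. x ^ j = \<alpha> * x + \<beta> + (x - d1) * (x - d2) * g x)"
  proof (induction j)
    case 0
    show ?case by (intro exI[of _ 0] exI[of _ 1] exI[of _ "\<lambda>_. 0"]) auto
  next
    case (Suc j)
    then obtain \<alpha> \<beta> g where g: "continuous_on UNIV g"
      and eq: "\<And>x. x ^ j = \<alpha> * x + \<beta> + (x - d1) * (x - d2) * g x" by blast
    have "x ^ Suc j = (\<alpha> * (d1 + d2) + \<beta>) * x + (- \<alpha> * d1 * d2) + (x - d1) * (x - d2) * (x * g x + \<alpha>)" for x
      by (simp add: eq algebra_simps)
    moreover have "continuous_on UNIV (\<lambda>x. x * g x + \<alpha>)" using g by (intro continuous_intros)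
    ultimately show ?case by blast
  qed
  with False show ?thesis by blast
qed

text \<open>At e - t and e + t the linear part is at most
  \<open>\<epsilon> * (2 + \<bar>e\<bar>)\<close> in absolute value. The other term is larger: the
  distance to e is t, the distance to e' is still at least half of that between the nodes, and S is
  at least \<open>\<sigma>\<close>. That term has opposite signs at the two points, so the
  intermediate value theorem gives a root.\<close>

lemma root_near_node:
  fixes e e' t :: real
  assumes t: "0 < t" "t \<le> 1" "t \<le> \<bar>e - e'\<bar> / 2"
    and cont: "continuous_on UNIV p"
    and p: "\<And>x. p x = l0 + l1 * x + (x - e) * (x - e') * S x"
    and S: "\<And>x. \<bar>x - e\<bar> \<le> 1 \<Longrightarrow> \<sigma> \<le> S x" and \<sigma>: "\<sigma> \<ge> 0"
    and l: "\<bar>l0\<bar> \<le> \<epsilon>" "\<bar>l1\<bar> \<le> \<epsilon>" and \<epsilon>: "\<epsilon> * (2 + \<bar>e\<bar>) < t * \<bar>e - e'\<bar> / 2 * \<sigma>"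
  shows "\<exists>z. \<bar>z - e\<bar> \<le> t \<and> p z = 0"
proof -
  have lin: "\<bar>l0 + l1 * x\<bar> \<le> \<epsilon> * (2 + \<bar>e\<bar>)" if "\<bar>x - e\<bar> \<le> 1" for x
  proof -
    have "\<bar>l0 + l1 * x\<bar> \<le> \<bar>l0\<bar> + \<bar>l1\<bar> * \<bar>x\<bar>" by (metis abs_mult abs_triangle_ineq)
    also have "\<dots> \<le> \<epsilon> + \<epsilon> * (1 + \<bar>e\<bar>)"
      using l that by (intro add_mono mult_mono) auto
    finally show ?thesis by (simp add: algebra_simps)
  qed
  have rem: "t * \<bar>e - e'\<bar> / 2 * \<sigma> \<le> t * w * S x" if "\<bar>x - e\<bar> \<le> 1" "w \<ge> \<bar>e - e'\<bar> / 2" for w x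
  proof -
    have "t * (\<bar>e - e'\<bar> / 2) * \<sigma> \<le> t * w * S x"
      using that S[OF that(1)] \<sigma> t by (intro mult_mono mult_nonneg_nonneg) auto
    then show ?thesis by simp
  qed
  have R: "p (e + t) = l0 + l1 * (e + t) + t * (e - e' + t) * S (e + t)"
    and L: "p (e - t) = l0 + l1 * (e - t) - t * (e - e' - t) * S (e - t)"
    by (simp_all add: p algebra_simps)
  have c: "continuous_on {e - t..e + t} p" using cont by (rule continuous_on_subset) simp
  have lin': "\<bar>l0 + l1 * (e + t)\<bar> \<le> \<epsilon> * (2 + \<bar>e\<bar>)" "\<bar>l0 + l1 * (e - t)\<bar> \<le> \<epsilon> * (2 + \<bar>e\<bar>)"
    using lin t by auto
  have "\<exists>z. e - t \<le> z \<and> z \<le> e + t \<and> p z = 0"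
  \<comment> \<open>The order of the nodes decides at which of the two points p is nonnegative; e =
    e' is excluded by 0 < t.\<close>
  proof (cases "e > e'")
    case True
    have "t * \<bar>e - e'\<bar> / 2 * \<sigma> \<le> t * (e - e' + t) * S (e + t)"
      by (rule rem) (use True t in \<open>auto simp: abs_if\<close>)
    moreover have "t * \<bar>e - e'\<bar> / 2 * \<sigma> \<le> t * (e - e' - t) * S (e - t)"
      by (rule rem) (use True t in \<open>auto simp: abs_if\<close>)
    ultimately have "p (e + t) \<ge> 0" "p (e - t) \<le> 0" using L R lin' \<epsilon> by linarith+
    then show ?thesis using IVT'[of p "e - t" 0 "e + t"] c t by auto
  next
    case False
    have "t * \<bar>e - e'\<bar> / 2 * \<sigma> \<le> t * - (e - e' + t) * S (e + t)"
      by (rule rem) (use False t in \<open>auto simp: abs_if\<close>)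
    moreover have "t * \<bar>e - e'\<bar> / 2 * \<sigma> \<le> t * - (e - e' - t) * S (e - t)"
      by (rule rem) (use False t in \<open>auto simp: abs_if\<close>)
    ultimately have "t * \<bar>e - e'\<bar> / 2 * \<sigma> \<le> - (t * (e - e' + t) * S (e + t))"
      "t * \<bar>e - e'\<bar> / 2 * \<sigma> \<le> - (t * (e - e' - t) * S (e - t))"
      by (simp_all only: mult_minus_left mult_minus_right)
    then have "p (e + t) \<le> 0" "p (e - t) \<ge> 0" using L R lin' \<epsilon> by linarith+
    then show ?thesis using IVT2'[of p "e + t" 0 "e - t"] c t by auto
  qed
  then obtain z where "e - t \<le> z" "z \<le> e + t" "p z = 0" by blast
  then show ?thesis by (intro exI[of _ z]) auto
qed

section \<open>The family of polynomials and the points it produces\<close>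

definition poly_of :: "(nat \<Rightarrow> int) \<Rightarrow> nat \<Rightarrow> int poly" where
  "poly_of a n = (\<Sum>j\<le>n. monom (a j) j)"

lemma coeff_poly_of: "coeff (poly_of a n) j = (if j \<le> n then a j else 0)"
  by (simp add: poly_of_def coeff_sum)

lemma degree_poly_of: "a n \<noteq> 0 \<Longrightarrow> degree (poly_of a n) = n"
  by (intro antisym degree_le le_degree) (auto simp: coeff_poly_of)

lemma real_eval_poly_of: "real_eval (poly_of a n) x = (\<Sum>j\<le>n. of_int (a j) * x ^ j)"
proof -
  have "real_eval (\<Sum>j\<in>A. monom (a j) j) x = (\<Sum>j\<in>A. of_int (a j) * x ^ j)" if "finite A" for A
    using that
  proof induction
    case (insert j A)
    have "real_eval (monom (a j) j) x = of_int (a j) * x ^ j"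
      by (simp add: real_eval_def map_poly_monom poly_monom)
    with insert show ?case by simp
  qed simp
  then show ?thesis by (simp add: poly_of_def)
qed

lemma height_poly_of_le:
  assumes "a n \<noteq> 0" "\<And>j. j \<le> n \<Longrightarrow> real_of_int \<bar>a j\<bar> \<le> Q"
  shows "real_of_int (height (poly_of a n)) \<le> Q"
proof -
  have "height (poly_of a n) \<le> \<lfloor>Q\<rfloor>"
    unfolding height_def degree_poly_of[of a n, OF assms(1)]
    by (rule Max.boundedI) (use assms(2) in \<open>auto simp: coeff_poly_of le_floor_iff\<close>)
  then show ?thesis by (simp add: le_floor_iff)
qed

text \<open>C bounds the interpolating lines and thereby controls heights; G bounds the remainders
  near the nodes and thereby controls signs.\<close>

locale interpolation =
  fixes n :: nat and d1 d2 C G :: real and \<alpha> \<beta> :: "nat \<Rightarrow> real" and g :: "nat \<Rightarrow> real \<Rightarrow> real"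
  assumes n: "n \<ge> 2"
    and remainder: "\<And>j x. x ^ j = \<alpha> j * x + \<beta> j + (x - d1) * (x - d2) * g j x"
    and g_2: "\<And>x. g 2 x = 1"
    and \<alpha>_le: "\<And>j. j \<le> n \<Longrightarrow> \<bar>\<alpha> j\<bar> \<le> C" and \<beta>_le: "\<And>j. j \<le> n \<Longrightarrow> \<bar>\<beta> j\<bar> \<le> C"
    and g_le: "\<And>j x. j \<le> n \<Longrightarrow> \<bar>x - d1\<bar> \<le> 1 \<or> \<bar>x - d2\<bar> \<le> 1 \<Longrightarrow> \<bar>g j x\<bar> \<le> G"
begin

lemma real_eval_interpolation:
  "real_eval (poly_of a n) x =
    (of_int (a 0) + (\<Sum>j=2..n. of_int (a j) * \<beta> j)) + (of_int (a 1) + (\<Sum>j=2..n. of_int (a j) * \<alpha> j)) * x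
    + (x - d1) * (x - d2) * (\<Sum>j=2..n. of_int (a j) * g j x)"
proof -
  have "{..n} = insert 0 (insert 1 {2..n})" using n by auto
  then have "real_eval (poly_of a n) x = of_int (a 0) + of_int (a 1) * x + (\<Sum>j=2..n. of_int (a j) * x ^ j)"
    by (simp add: real_eval_poly_of)
  also have "(\<Sum>j=2..n. of_int (a j) * x ^ j) =
      (\<Sum>j=2..n. of_int (a j) * \<beta> j + of_int (a j) * \<alpha> j * x + (x - d1) * (x - d2) * (of_int (a j) * g j x))"
    by (intro sum.cong refl, subst remainder) (simp add: algebra_simps)
  also have "\<dots> = (\<Sum>j=2..n. of_int (a j) * \<beta> j) + (\<Sum>j=2..n. of_int (a j) * \<alpha> j) * x
      + (x - d1) * (x - d2) * (\<Sum>j=2..n. of_int (a j) * g j x)"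
    by (simp only: sum.distrib sum_distrib_left sum_distrib_right)
  finally show ?thesis by (simp add: distrib_right)
qed

text \<open>As \<open>g 2\<close> is 1, the term for j = 2 contributes at least 2NB. The fewer than
  n other terms are each at most 2BG, together at most NB.\<close>

lemma interpolation_factor_ge:
  fixes N B :: nat
  assumes N: "real N \<ge> 2 * real n * G"
    and a2: "a 2 \<ge> 2 * int N * int B"
    and a: "\<And>j. 3 \<le> j \<Longrightarrow> j \<le> n \<Longrightarrow> \<bar>a j\<bar> \<le> 2 * int B"
    and x: "\<bar>x - d1\<bar> \<le> 1 \<or> \<bar>x - d2\<bar> \<le> 1"
  shows "real N * real B \<le> (\<Sum>j=2..n. of_int (a j) * g j x)"
proof -
  have G: "G \<ge> 0" using g_le[of 0 x] x by linarith
  have "\<bar>\<Sum>j=3..n. of_int (a j) * g j x\<bar> \<le> (\<Sum>j=3..n. 2 * real B * G)"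
  proof (rule order.trans[OF sum_abs sum_mono])
    fix j assume j: "j \<in> {3..n}"
    have "\<bar>real_of_int (a j)\<bar> \<le> 2 * real B" using a[of j] j by simp
    then show "\<bar>of_int (a j) * g j x\<bar> \<le> 2 * real B * G"
      unfolding abs_mult using g_le[of j x] j x by (intro mult_mono) auto
  qed
  also have "\<dots> = real (n - 2) * (2 * real B * G)" using n by simp
  also have "\<dots> \<le> real n * (2 * real B * G)" using G by (intro mult_right_mono) auto
  also have "\<dots> = (2 * real n * G) * real B" by simp
  also have "\<dots> \<le> real N * real B" using N by (intro mult_right_mono) auto
  finally have tail: "\<bar>\<Sum>j=3..n. of_int (a j) * g j x\<bar> \<le> real N * real B" .
  have "{2..n} = insert 2 {3..n}" using n by auto
  then have "(\<Sum>j=2..n. of_int (a j) * g j x) = of_int (a 2) + (\<Sum>j=3..n. of_int (a j) * g j x)"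
    by (simp add: g_2)
  moreover have "real_of_int (a 2) \<ge> 2 * (real N * real B)"
    using of_int_le_iff[where 'a = real, THEN iffD2, OF a2] by simp
  ultimately show ?thesis using tail by linarith
qed

text \<open>There are B^(n-1) choices of the coefficients of index at least 2, each with at least
  T^2/2 admissible pairs for the two lowest ones. The bounds \<open>Q\<close> keep the height in
  range, \<open>log\<close> feeds the coprimality count, and \<open>small\<close> forces a root
  within t of each node.\<close>

lemma card_algebraic_points_ge:
  fixes N B T :: nat
  assumes N: "real N \<ge> 2 * real n * G" "N > 0" and B: "B > 0" and T: "T > 0"
    and Q: "2 * (real N + 1) * real B * real n * C + 4 * real T \<le> Q" "2 * (real N + 1) * real B \<le> Q"
    and log: "12 * log 2 Q \<le> real T"
    and t: "0 < t" "t \<le> 1" "t \<le> \<bar>d1 - d2\<bar> / 2"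
    and small: "4 * real T * (2 + \<bar>d1\<bar>) < t * \<bar>d1 - d2\<bar> / 2 * (real N * real B)"
      "4 * real T * (2 + \<bar>d2\<bar>) < t * \<bar>d1 - d2\<bar> / 2 * (real N * real B)"
  shows "real B ^ (n - 1) * (real T)\<^sup>2 / 2 \<le>
    real (card (algebraic_points n Q \<inter> {d1 - t..d1 + t} \<times> {d2 - t..d2 + t}))"
proof -
  define F where "F = (\<Pi>\<^sub>E j\<in>{2..n}. {..<B})"
  \<comment> \<open>The 1 at j = n makes the leading coefficient odd while the coefficients below it
    stay even; the shift 2NB at j = 2 makes that coefficient dominant. For n = 2 both apply.\<close>
  define b :: "(nat \<Rightarrow> nat) \<Rightarrow> nat \<Rightarrow> int" where
    "b f j = 2 * int (f j) + (if j = n then 1 else 0) + (if j = 2 then 2 * int N * int B else 0)" for f j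
  \<comment> \<open>Up to a bounded error, \<open>u f\<close> and \<open>v f\<close> annihilate the
    linear part, so that adding 4x and 4y with x, y < T leaves \<open>l0\<close> and
    \<open>l1\<close> at most 4T in absolute value. Modulo 4 they are 2 and 0, hence the constant
    coefficient is 2 modulo 4, as Eisenstein's criterion at 2 requires.\<close>
  define u where "u f = 4 * \<lfloor>- (\<Sum>j=2..n. of_int (b f j) * \<beta> j) / 4\<rfloor> + 2" for f
  define v where "v f = 4 * \<lfloor>- (\<Sum>j=2..n. of_int (b f j) * \<alpha> j) / 4\<rfloor>" for f
  define a where "a f x y j = (if j = 0 then 4 * int x + u f else if j = 1 then 4 * int y + v f else b f j)"
    for f x y and j :: nat
  \<comment> \<open>No prime divides the leading coefficient and both lowest coefficients; this
    already makes the polynomial primitive.\<close>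
  define W where "W f = {(x, y) \<in> {..<T} \<times> {..<T}. \<forall>p. prime p \<longrightarrow>
      \<not> (p dvd nat (b f n) \<and> int p dvd 4 * int x + u f \<and> int p dvd 4 * int y + v f)}" for f
  let ?\<Omega> = "Sigma F W"
  define P where "P = (\<lambda>(f, x, y). poly_of (a f x y) n)"
  let ?S = "algebraic_points n Q \<inter> {d1 - t..d1 + t} \<times> {d2 - t..d2 + t}"

  have b_tail: "0 \<le> b f j" "b f j \<le> 2 * int B" if "f \<in> F" "3 \<le> j" "j \<le> n" for f j
    using that PiE_mem[of f "{2..n}" "\<lambda>_. {..<B}" j] unfolding F_def b_def by auto
  have b_bound: "0 \<le> b f j" "real_of_int (b f j) \<le> 2 * (real N + 1) * real B"
    if "f \<in> F" "j \<in> {2..n}" for f j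
  proof -
    have fj: "f j < B" using that PiE_mem[of f "{2..n}" "\<lambda>_. {..<B}" j] unfolding F_def by auto
    show "0 \<le> b f j" by (simp add: b_def)
    define m where "m = 2 * int N * int B"
    have "m \<ge> 0" by (simp add: m_def)
    then have "b f j \<le> 2 * int B + m" using fj unfolding b_def m_def[symmetric] by auto
    also have "\<dots> = 2 * (int N + 1) * int B" by (simp add: m_def algebra_simps)
    finally have "b f j \<le> 2 * (int N + 1) * int B" .
    then have "real_of_int (b f j) \<le> real_of_int (2 * (int N + 1) * int B)" by (simp only: of_int_le_iff)
    then show "real_of_int (b f j) \<le> 2 * (real N + 1) * real B" by simp
  qed
  have b2: "b f 2 \<ge> 2 * int N * int B" for f by (simp add: b_def)
  have bn: "odd (b f n)" "b f n > 0" "odd (nat (b f n))" for f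
  proof -
    show odd: "odd (b f n)" by (simp add: b_def)
    have "b f n \<ge> 0" by (simp add: b_def)
    with odd show "b f n > 0" by (cases "b f n = 0") auto
    with odd show "odd (nat (b f n))" by (simp add: even_nat_iff)
  qed
  have b_even: "even (b f j)" if "j < n" for f j using that by (simp add: b_def)
  have an: "a f x y n = b f n" for f x y using n by (simp add: a_def)
  have card_W: "real (card (W f)) \<ge> (real T)\<^sup>2 / 2" if "f \<in> F" for f
    unfolding W_def
  proof (rule card_coprime_pairs_ge[OF _ _ T log])
    show "real (nat (b f n)) \<le> Q" using b_bound[OF that, of n] n Q(2) bn(2)[of f] by simp
  qed (rule bn)
  have irr: "irreducible (P w)" "content (P w) = 1" "degree (P w) = n" "coeff (P w) 2 > 0"
    if w: "w \<in> ?\<Omega>" for w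
  proof -
    obtain f x y where w_eq: "w = (f, x, y)" and xy: "(x, y) \<in> W f" using w by auto
    have nz: "a f x y n \<noteq> 0" using bn(2)[of f] by (simp add: an)
    show deg: "degree (P w) = n" by (simp add: P_def w_eq degree_poly_of nz)
    have coeff: "coeff (P w) j = (if j \<le> n then a f x y j else 0)" for j
      by (simp add: P_def w_eq coeff_poly_of)
    show cont: "content (P w) = 1"
    proof (rule ccontr)
      assume "content (P w) \<noteq> 1"
      then have "\<not> is_unit (content (P w))" by (simp only: is_unit_content_iff not_False_eq_True)
      moreover have "content (P w) \<noteq> 0" using deg n by auto
      ultimately obtain q where q: "prime q" "q dvd content (P w)" using prime_divisorE by blast
      have dvd: "q dvd coeff (P w) j" for j using q(2) content_dvd_coeff dvd_trans by blast
      define p where "p = nat q"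
      have p: "prime p" "int p = q" using q(1) prime_ge_0_int[of q] by (auto simp: p_def prime_nat_iff_prime)
      have "int p dvd 4 * int x + u f" using dvd[of 0] by (simp add: coeff a_def p)
      moreover have "int p dvd 4 * int y + v f" using dvd[of 1] n by (simp add: coeff a_def p)
      moreover have "int p dvd b f n" using dvd[of n] by (simp add: coeff an p)
      then have "p dvd nat (b f n)" using bn(2)[of f] by (simp add: int_dvd_int_iff[symmetric])
      ultimately show False using xy p(1) unfolding W_def by blast
    qed
    show "irreducible (P w)"
    proof (rule eisenstein_criterion[of 2])
      show "\<not> 2 dvd lead_coeff (P w)" using bn(1) by (simp add: deg coeff an)
      show "2 dvd coeff (P w) i" if "i < degree (P w)" for i
        using that by (auto simp: deg coeff a_def u_def v_def b_even)
      have "coeff (P w) 0 mod 4 = 2" by (simp add: coeff a_def u_def)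
      then show "\<not> 2\<^sup>2 dvd coeff (P w) 0" by auto
    qed (use cont deg n in auto)
    have "0 < 2 * int N * int B" using N B by simp
    also note b2[of f]
    finally show "coeff (P w) 2 > 0" using n by (simp add: coeff a_def)
  qed
  have inj: "inj_on P ?\<Omega>"
  proof (rule inj_onI)
    fix w w' assume w: "w \<in> ?\<Omega>" "w' \<in> ?\<Omega>" "P w = P w'"
    obtain f x y f' x' y' where w_eq: "w = (f, x, y)" "w' = (f', x', y')" by (metis prod_cases3)
    have *: "f \<in> F" "f' \<in> F" "P (f, x, y) = P (f', x', y')" using w by (auto simp: w_eq)
    have eq: "a f x y j = a f' x' y' j" if "j \<le> n" for j
      using arg_cong[OF *(3), of "\<lambda>p. coeff p j"] that by (simp add: P_def coeff_poly_of)
    \<comment> \<open>The coefficients of index at least 2 determine f, since the shifts in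
      \<open>b\<close> are the same for every f. Then \<open>u f\<close> and \<open>v f\<close> are
      known, and the two lowest coefficients give x and y.\<close>
    have "f = f'"
    proof (rule PiE_ext)
      show "f \<in> (\<Pi>\<^sub>E j\<in>{2..n}. {..<B})" "f' \<in> (\<Pi>\<^sub>E j\<in>{2..n}. {..<B})" using * by (auto simp: F_def)
      show "f j = f' j" if "j \<in> {2..n}" for j using eq[of j] that by (simp add: a_def b_def)
    qed
    moreover from this have "x = x'" "y = y'" using eq[of 0] eq[of 1] n by (auto simp: a_def)
    ultimately show "w = w'" by (simp add: w_eq)
  qed
  have ex: "\<exists>z. z \<in> ?S \<and> vanishes_at (P w) z" if w: "w \<in> ?\<Omega>" for w
  proof -
    obtain f x y where w_eq: "w = (f, x, y)" and f: "f \<in> F" and xy: "x < T" "y < T"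
      using w by (auto simp: W_def)
    have ab: "a f x y j = b f j" if "j \<in> {2..n}" for j using that by (auto simp: a_def)
    have sum_eq: "(\<Sum>j=2..n. of_int (a f x y j) * k j) = (\<Sum>j=2..n. of_int (b f j) * k j)"
      for k :: "nat \<Rightarrow> real" by (rule sum.cong) (auto simp: ab)
    define l0 where "l0 = of_int (a f x y 0) + (\<Sum>j=2..n. of_int (a f x y j) * \<beta> j)"
    define l1 where "l1 = of_int (a f x y 1) + (\<Sum>j=2..n. of_int (a f x y j) * \<alpha> j)"
    define R where "R z = (\<Sum>j=2..n. of_int (a f x y j) * g j z)" for z
    have xyT: "real x + 1 \<le> real T" "real y + 1 \<le> real T" using xy by simp_all
    have l0: "\<bar>l0\<bar> \<le> 4 * real T"
      unfolding l0_def sum_eq using xyT by (simp add: a_def u_def) linarith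
    have l1: "\<bar>l1\<bar> \<le> 4 * real T"
      unfolding l1_def sum_eq using xyT by (simp add: a_def v_def) linarith
    have eval: "real_eval (P w) z = l0 + l1 * z + (z - d1) * (z - d2) * R z" for z
      unfolding P_def w_eq l0_def l1_def R_def by (simp only: split real_eval_interpolation)
    have cont: "continuous_on UNIV (real_eval (P w))" unfolding real_eval_def by (intro continuous_intros)
    have R: "real N * real B \<le> R z" if "\<bar>z - d1\<bar> \<le> 1 \<or> \<bar>z - d2\<bar> \<le> 1" for z
      unfolding R_def
    proof (rule interpolation_factor_ge[OF N(1) _ _ that])
      show "2 * int N * int B \<le> a f x y 2" using b2 n by (simp add: ab)
      show "\<bar>a f x y j\<bar> \<le> 2 * int B" if "3 \<le> j" "j \<le> n" for j
        using that b_tail[OF f that] by (simp add: ab)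
    qed
    have "\<exists>z. \<bar>z - d1\<bar> \<le> t \<and> real_eval (P w) z = 0"
      by (rule root_near_node[OF t cont eval R _ l0 l1 small(1)]) auto
    then obtain z1 where z1: "\<bar>z1 - d1\<bar> \<le> t" "real_eval (P w) z1 = 0" by blast
    \<comment> \<open>The decomposition is symmetric in the nodes, so the same factor
      \<open>R\<close> serves with their roles exchanged.\<close>
    have "\<exists>z. \<bar>z - d2\<bar> \<le> t \<and> real_eval (P w) z = 0"
    proof (rule root_near_node[where e' = d1 and S = R, OF t(1,2) _ cont _ _ _ l0 l1])
      show "t \<le> \<bar>d2 - d1\<bar> / 2" using t(3) by (simp add: abs_minus_commute)
      show "real_eval (P w) z = l0 + l1 * z + (z - d2) * (z - d1) * R z" for z
        by (simp add: eval mult.commute)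
      show "4 * real T * (2 + \<bar>d2\<bar>) < t * \<bar>d2 - d1\<bar> / 2 * (real N * real B)"
        using small(2) by (simp add: abs_minus_commute)
    qed (use R in auto)
    then obtain z2 where z2: "\<bar>z2 - d2\<bar> \<le> t" "real_eval (P w) z2 = 0" by blast
    have van: "vanishes_at (P w) (z1, z2)" using z1 z2 by (simp add: vanishes_at_def)
    have sum_le: "\<bar>\<Sum>j=2..n. of_int (b f j) * k j\<bar> \<le> 2 * (real N + 1) * real B * real n * C"
      if k: "\<And>j. j \<le> n \<Longrightarrow> \<bar>k j\<bar> \<le> C" for k :: "nat \<Rightarrow> real"
    proof -
      have C: "C \<ge> 0" using k[of 0] by simp
      have "\<bar>\<Sum>j=2..n. of_int (b f j) * k j\<bar> \<le> (\<Sum>j=2..n. (2 * (real N + 1) * real B) * C)"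
      proof (rule order.trans[OF sum_abs sum_mono])
        fix j assume j: "j \<in> {2..n}"
        show "\<bar>of_int (b f j) * k j\<bar> \<le> (2 * (real N + 1) * real B) * C"
          unfolding abs_mult using b_bound[OF f j] k[of j] j by (intro mult_mono) auto
      qed
      also have "\<dots> = real (n - 1) * (2 * (real N + 1) * real B * C)" using n by simp
      also have "\<dots> \<le> real n * (2 * (real N + 1) * real B * C)" using C by (intro mult_right_mono) auto
      finally show ?thesis by (simp add: algebra_simps)
    qed
    have "real_of_int (height (P w)) \<le> Q"
      unfolding P_def w_eq split
    proof (rule height_poly_of_le)
      show "a f x y n \<noteq> 0" using bn(2)[of f] by (simp add: an)
      fix j assume j: "j \<le> n"
      consider "j = 0" | "j = 1" | "j \<in> {2..n}" using j by fastforce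
      then show "real_of_int \<bar>a f x y j\<bar> \<le> Q"
      proof cases
        case 1
        \<comment> \<open>The lowest coefficient is the small \<open>l0\<close> minus the
          interpolation sum, which may have order B; the next coefficient is treated alike.\<close>
        have "\<bar>of_int (a f x y 0)\<bar> \<le> \<bar>l0\<bar> + \<bar>\<Sum>j=2..n. of_int (b f j) * \<beta> j\<bar>"
          unfolding l0_def sum_eq by linarith
        then show ?thesis using l0 sum_le[of \<beta>, OF \<beta>_le] Q(1) 1 by simp
      next
        case 2
        have "\<bar>of_int (a f x y 1)\<bar> \<le> \<bar>l1\<bar> + \<bar>\<Sum>j=2..n. of_int (b f j) * \<alpha> j\<bar>"
          unfolding l1_def sum_eq by linarith
        then show ?thesis using l1 sum_le[of \<alpha>, OF \<alpha>_le] Q(1) 2 by simp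
      next
        case 3
        then show ?thesis using b_bound[OF f 3] Q(2) by (simp add: ab)
      qed
    qed
    moreover have "minimal_polynomial (P w) (z1, z2)"
      using irr[OF w] n van by (intro irreducible_minimal_polynomial) auto
    ultimately have "(z1, z2) \<in> algebraic_points n Q"
      using irr[OF w] van unfolding algebraic_points_def algebraic_point_def by auto
    moreover have "(z1, z2) \<in> {d1 - t..d1 + t} \<times> {d2 - t..d2 + t}"
      using z1(1) z2(1) by (auto simp: abs_le_iff)
    ultimately show ?thesis using van by blast
  qed
  then obtain z where z: "\<And>w. w \<in> ?\<Omega> \<Longrightarrow> z w \<in> ?S" "\<And>w. w \<in> ?\<Omega> \<Longrightarrow> vanishes_at (P w) (z w)"
    by metis
  \<comment> \<open>Equal points give a common root of two irreducible polynomials with positive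
    coefficient at index 2, hence equal polynomials.\<close>
  have "inj_on z ?\<Omega>"
  proof (rule inj_onI)
    fix w w' assume w: "w \<in> ?\<Omega>" "w' \<in> ?\<Omega>" and eq: "z w = z w'"
    have "P w = P w'"
      using irreducible_eq_if_common_root[OF irr(1)[OF w(1)] irr(1)[OF w(2)] _ _ irr(4)[OF w(1)] irr(4)[OF w(2)]]
        z(2)[OF w(1)] z(2)[OF w(2)] eq by (auto simp: vanishes_at_def)
    then show "w = w'" using inj w by (auto dest: inj_onD)
  qed
  moreover have "z ` ?\<Omega> \<subseteq> ?S" using z(1) by blast
  ultimately have le: "card ?\<Omega> \<le> card ?S"
    by (intro card_inj_on_le) (auto simp: finite_algebraic_points)
  have fin_F: "finite F" unfolding F_def by (intro finite_PiE) auto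
  have fin_W: "finite (W f)" for f
    by (rule finite_subset[of _ "{..<T} \<times> {..<T}"]) (auto simp: W_def)
  have "card F = B ^ (n - 1)" using n by (simp add: F_def card_PiE)
  then have "real B ^ (n - 1) * (real T)\<^sup>2 / 2 = (\<Sum>f\<in>F. (real T)\<^sup>2 / 2)" by simp
  also have "\<dots> \<le> (\<Sum>f\<in>F. real (card (W f)))" by (intro sum_mono card_W)
  also have "\<dots> = real (card ?\<Omega>)" using fin_F fin_W by (simp add: card_SigmaI)
  also have "\<dots> \<le> real (card ?S)" using le by simp
  finally show ?thesis .
qed

end

section \<open>Choice of the constants and the final count\<close>

text \<open>These are the requirements for B = floor(c Q), T =
  floor(\<open>\<kappa> * c8 * Q powr (1 - \<gamma>)\<close>) and t equal to a quarter of the side.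
  As \<open>\<gamma>\<close> < 1, T outgrows the logarithm; as \<open>\<gamma>\<close> > 0, T is
  small against Q and t tends to 0. The lower bounds 2 ensure that taking floors loses at most a
  factor 2.\<close>

lemma eventually_scales:
  fixes c \<gamma> \<kappa> c8 D :: real
  assumes "0 < \<gamma>" "\<gamma> < 1" "c > 0" "\<kappa> > 0" "c8 > 0" "D > 0"
  shows "\<forall>\<^sub>F Q in at_top. 2 \<le> c * Q \<and> 2 \<le> \<kappa> * c8 * Q powr (1 - \<gamma>) \<and>
    24 * log 2 Q \<le> \<kappa> * c8 * Q powr (1 - \<gamma>) \<and> 8 * (\<kappa> * c8 * Q powr (1 - \<gamma>)) \<le> Q \<and>
    c8 * Q powr (- \<gamma>) / 4 \<le> 1 \<and> c8 * Q powr (- \<gamma>) / 4 \<le> D \<and> Q > (0::real)"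
proof -
  have k: "\<kappa> * c8 > 0" using assms by simp
  have 1: "\<forall>\<^sub>F Q in at_top. 2 \<le> c * Q" using assms by real_asymp
  have 2: "\<forall>\<^sub>F Q in at_top. 2 \<le> k * Q powr (1 - \<gamma>)" if "k > 0" for k :: real using assms that by real_asymp
  have 3: "\<forall>\<^sub>F Q in at_top. 24 * (ln Q / ln 2) \<le> k * Q powr (1 - \<gamma>)" if "k > 0" for k :: real
    using assms that by real_asymp
  have 4: "\<forall>\<^sub>F Q in at_top. 8 * (k * Q powr (1 - \<gamma>)) \<le> Q" if "k > 0" for k :: real
    using assms that by real_asymp
  have 5: "\<forall>\<^sub>F Q in at_top. c8 * Q powr (- \<gamma>) / 4 \<le> D" if "D > 0" for D :: real
    using assms that by real_asymp
  show ?thesis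
    using 1 2[OF k] 3[OF k] 4[OF k] 5[of 1] 5[OF assms(6)] eventually_gt_at_top[of 0]
    by (simp add: log_def eventually_conj_iff)
qed

text \<open>The remainders are continuous, hence bounded on the compact union of the unit balls
  around the nodes; summing over j gives bounds uniform in j. The bound C at least 1 lets the height
  estimate for the two lowest coefficients cover the others.\<close>

lemma ex_interpolation:
  assumes "n \<ge> 2"
  shows "\<exists>C G \<alpha> \<beta> g. C \<ge> 1 \<and> interpolation n d1 d2 C G \<alpha> \<beta> g"
proof -
  have "\<forall>j. \<exists>\<alpha> \<beta> g. continuous_on UNIV g \<and> (j = 2 \<longrightarrow> (\<forall>x. g x = 1)) \<and>
      (\<forall>x. x ^ j = \<alpha> * x + \<beta> + (x - d1) * (x - d2) * g x)"
    using linear_interpolation_remainder[of _ d1 d2] by blast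
  then obtain \<alpha> \<beta> g where g: "\<And>j. continuous_on UNIV (g j)" "\<And>x. g 2 x = 1"
    and rem: "\<And>j x. x ^ j = \<alpha> j * x + \<beta> j + (x - d1) * (x - d2) * g j x"
    by metis
  let ?K = "cball d1 1 \<union> cball d2 1"
  have "\<exists>M. \<forall>x\<in>?K. \<bar>g j x\<bar> \<le> M" for j
  proof -
    have "compact (g j ` ?K)"
      using g(1) by (intro compact_continuous_image) (auto intro: continuous_on_subset compact_Un)
    then have "bounded (g j ` ?K)" by (rule compact_imp_bounded)
    then show ?thesis unfolding bounded_iff by auto
  qed
  then obtain M where M: "\<And>j x. x \<in> ?K \<Longrightarrow> \<bar>g j x\<bar> \<le> M j" by metis
  define G where "G = (\<Sum>j\<le>n. \<bar>M j\<bar>)"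
  define C where "C = 1 + (\<Sum>j\<le>n. \<bar>\<alpha> j\<bar> + \<bar>\<beta> j\<bar>)"
  have C: "\<bar>\<alpha> j\<bar> + \<bar>\<beta> j\<bar> \<le> C" if "j \<le> n" for j
    unfolding C_def using member_le_sum[of j "{..n}" "\<lambda>j. \<bar>\<alpha> j\<bar> + \<bar>\<beta> j\<bar>"] that by auto
  have G: "\<bar>M j\<bar> \<le> G" if "j \<le> n" for j
    unfolding G_def using member_le_sum[of j "{..n}" "\<lambda>j. \<bar>M j\<bar>"] that by auto
  have "interpolation n d1 d2 C G \<alpha> \<beta> g"
  proof
    show "\<bar>\<alpha> j\<bar> \<le> C" "\<bar>\<beta> j\<bar> \<le> C" if "j \<le> n" for j using C[OF that] by auto
    show "\<bar>g j x\<bar> \<le> G" if "j \<le> n" "\<bar>x - d1\<bar> \<le> 1 \<or> \<bar>x - d2\<bar> \<le> 1" for j x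
      using M[of x j] G[OF that(1)] that(2) by (force simp: dist_real_def abs_minus_commute)
  qed (use assms rem g(2) in auto)
  moreover have "C \<ge> 1" unfolding C_def by (auto intro!: sum_nonneg add_nonneg_nonneg)
  ultimately show ?thesis by blast
qed

lemma half_le_nat_floor:
  fixes x :: real
  assumes "x \<ge> 2"
  shows "x / 2 \<le> real (nat \<lfloor>x\<rfloor>)" "real (nat \<lfloor>x\<rfloor>) \<le> x"
  using assms by linarith+

theorem theorem4:
  fixes n :: nat and d :: "real \<times> real"
  assumes "n \<ge> 2" and "fst d \<noteq> snd d"
  shows "\<exists>c\<^sub>0>0. \<forall>\<gamma>::real. 1 / 2 < \<gamma> \<and> \<gamma> < 1 \<longrightarrow>
    (\<exists>c\<^sub>1\<^sub>3>0. \<forall>c\<^sub>8>c\<^sub>0. \<exists>Q\<^sub>0. \<forall>Q>Q\<^sub>0. \<forall>I\<^sub>1 I\<^sub>2.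
       interval_with (fst d) (c\<^sub>8 * Q powr (- \<gamma>)) I\<^sub>1 \<longrightarrow>
       interval_with (snd d) (c\<^sub>8 * Q powr (- \<gamma>)) I\<^sub>2 \<longrightarrow>
       special d \<gamma> Q (1 / 2) (1 / 2) (I\<^sub>1 \<times> I\<^sub>2) \<longrightarrow>
       real (card (algebraic_points n Q \<inter> I\<^sub>1 \<times> I\<^sub>2)) >
         c\<^sub>1\<^sub>3 * Q powr (real n + 1) * measure lebesgue (I\<^sub>1 \<times> I\<^sub>2))"
proof -
  define d1 d2 where "d1 = fst d" and "d2 = snd d"
  define D where "D = \<bar>d1 - d2\<bar>"
  have D: "D > 0" using assms(2) by (simp add: D_def d1_def d2_def)
  obtain C G \<alpha> \<beta> g where C: "C \<ge> 1" and "interpolation n d1 d2 C G \<alpha> \<beta> g"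
    using ex_interpolation[OF assms(1)] by blast
  then interpret interpolation n d1 d2 C G \<alpha> \<beta> g by simp
  define N where "N = nat \<lceil>2 * real n * G\<rceil> + 1"
  have N: "real N \<ge> 2 * real n * G" "N > 0" unfolding N_def by linarith+
  \<comment> \<open>With B at most c Q the interpolation sums take up at most Q/2 of the height,
    which leaves room for 4T.\<close>
  define c where "c = 1 / (4 * (real N + 1) * real n * C)"
  have nC: "real n * C \<ge> 1"
    using mult_mono[of 1 "real n" 1 C] n C by simp
  have c: "c > 0" using n C by (simp add: c_def)
  have cN: "4 * (real N + 1) * c * real n * C = 1" using n C by (simp add: c_def)
  define M where "M = 2 + \<bar>d1\<bar> + \<bar>d2\<bar>"
  have M: "M > 0" by (simp add: M_def)
  \<comment> \<open>With X as below and s the side, 4 X M equals D N c Q s / 32. This is half of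
    (s/4)(D/2) N (c Q/2), the lower bound for the quadratic term, so the condition
    \<open>small\<close> holds strictly.\<close>
  define \<kappa> where "\<kappa> = D * real N * c / (128 * M)"
  have \<kappa>: "\<kappa> > 0" using D N c M by (simp add: \<kappa>_def)
  \<comment> \<open>The count yields this expression with 8 in place of 16; the spare factor 2 makes
    the final inequality strict.\<close>
  define c13 where "c13 = (c / 2) ^ (n - 1) * \<kappa>\<^sup>2 / 16"
  have c13: "c13 > 0" using c \<kappa> by (simp add: c13_def)
  have main: "c13 * Q powr (real n + 1) * measure lebesgue (I \<times> J) < real (card (algebraic_points n Q \<inter> I \<times> J))"
    if Q: "2 \<le> c * Q \<and> 2 \<le> \<kappa> * c8 * Q powr (1 - \<gamma>) \<and>
        24 * log 2 Q \<le> \<kappa> * c8 * Q powr (1 - \<gamma>) \<and> 8 * (\<kappa> * c8 * Q powr (1 - \<gamma>)) \<le> Q \<and>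
        c8 * Q powr (- \<gamma>) / 4 \<le> 1 \<and> c8 * Q powr (- \<gamma>) / 4 \<le> D / 2 \<and> Q > 0"
      and c8: "c8 > 0"
      and I: "interval_with d1 (c8 * Q powr (- \<gamma>)) I"
      and J: "interval_with d2 (c8 * Q powr (- \<gamma>)) J" for \<gamma> c8 Q I J
  proof -
    define s where "s = c8 * Q powr (- \<gamma>)"
    define X where "X = \<kappa> * c8 * Q powr (1 - \<gamma>)"
    define B T where "B = nat \<lfloor>c * Q\<rfloor>" and "T = nat \<lfloor>X\<rfloor>"
    have Q0: "Q > 0" using Q by blast
    have s: "s > 0" using c8 Q0 by (simp add: s_def)
    have X_eq: "X = \<kappa> * Q * s"
      using Q0 by (simp add: X_def s_def powr_diff powr_minus field_simps)
    have B: "c * Q / 2 \<le> real B" "real B \<le> c * Q" unfolding B_def using Q half_le_nat_floor[of "c * Q"] by simp_all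
    have T: "X / 2 \<le> real T" "real T \<le> X" unfolding T_def using Q half_le_nat_floor[of X] by (simp_all add: X_def)
    have pos: "B > 0" "T > 0" using B(1) T(1) Q by (auto simp: X_def intro!: Nat.gr0I)
    have BQ: "2 * (real N + 1) * real B * real n * C \<le> Q / 2"
    proof -
      have "2 * (real N + 1) * real B * real n * C \<le> 2 * (real N + 1) * (c * Q) * real n * C"
        using B(2) C by (intro mult_right_mono mult_left_mono) auto
      also have "\<dots> = (4 * (real N + 1) * c * real n * C) * Q / 2" by simp
      finally show ?thesis unfolding cN by simp
    qed
    have "2 * (real N + 1) * real B * 1 \<le> 2 * (real N + 1) * real B * (real n * C)"
      using nC by (intro mult_left_mono) auto
    also have "\<dots> \<le> Q / 2" using BQ by (simp only: mult.assoc)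
    finally have BQ': "2 * (real N + 1) * real B \<le> Q" using Q0 by simp
    have small: "4 * real T * w < s / 4 * \<bar>d1 - d2\<bar> / 2 * (real N * real B)" if "0 \<le> w" "w \<le> M" for w
    proof -
      have "4 * real T * w \<le> 4 * X * M" using T that by (intro mult_mono) auto
      also have "\<dots> = D * real N * c * Q * s / 32" using M by (simp add: X_eq \<kappa>_def)
      also have "\<dots> < D * real N * c * Q * s / 16" using D N c Q0 s by simp
      also have "\<dots> = (s / 4 * D / 2 * real N) * (c * Q / 2)" by simp
      also have "\<dots> \<le> (s / 4 * D / 2 * real N) * real B" using B s D by (intro mult_left_mono) auto
      finally show ?thesis by (simp add: D_def mult.assoc)
    qed
    let ?A = "algebraic_points n Q"
    have "real B ^ (n - 1) * (real T)\<^sup>2 / 2 \<le>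
        real (card (?A \<inter> {d1 - s / 4..d1 + s / 4} \<times> {d2 - s / 4..d2 + s / 4}))"
    proof (rule card_algebraic_points_ge[OF N pos _ BQ'])
      show "2 * (real N + 1) * real B * real n * C + 4 * real T \<le> Q"
        using BQ T(2) Q by (simp add: X_def)
      show "12 * log 2 Q \<le> real T" using T(1) Q by (simp add: X_def)
      show "0 < s / 4" "s / 4 \<le> 1" "s / 4 \<le> \<bar>d1 - d2\<bar> / 2" using s Q by (simp_all add: s_def D_def)
    qed (rule small; simp add: M_def)+
    also have "\<dots> \<le> real (card (?A \<inter> I \<times> J))"
    proof -
      \<comment> \<open>The roots are sought within a quarter of the side, so they are interior to
        the square whether or not its edges belong to it.\<close>
      have "{d1 - s / 4..d1 + s / 4} \<subseteq> {d1 - s / 2<..<d1 + s / 2}"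
        "{d2 - s / 4..d2 + s / 4} \<subseteq> {d2 - s / 2<..<d2 + s / 2}" using s by auto
      then have "{d1 - s / 4..d1 + s / 4} \<subseteq> I" "{d2 - s / 4..d2 + s / 4} \<subseteq> J"
        using interval_with_bounds(1)[OF I] interval_with_bounds(1)[OF J] unfolding s_def by blast+
      then show ?thesis
        unfolding of_nat_le_iff by (intro card_mono) (auto simp: finite_algebraic_points)
    qed
    finally have card: "real B ^ (n - 1) * (real T)\<^sup>2 / 2 \<le> real (card (?A \<inter> I \<times> J))" .
    have Qn: "Q powr (real n + 1) = Q ^ (n - 1) * Q\<^sup>2"
    proof -
      have "real n + 1 = real ((n - 1) + 2)" using n by simp
      then show ?thesis using Q0 by (simp only: powr_realpow power_add)
    qed
    have "measure lebesgue (I \<times> J) \<le> s\<^sup>2"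
      using measure_Times_interval_with_le[OF I J] s by (simp add: s_def)
    then have "c13 * Q powr (real n + 1) * measure lebesgue (I \<times> J) \<le> c13 * Q powr (real n + 1) * s\<^sup>2"
      using c13 by (intro mult_left_mono) auto
    also have "\<dots> < 2 * (c13 * Q powr (real n + 1) * s\<^sup>2)" using c13 Q0 s by simp
    also have "\<dots> = (c * Q / 2) ^ (n - 1) * (X / 2)\<^sup>2 / 2"
      by (simp add: c13_def Qn X_eq power_mult_distrib power_divide)
    also have "\<dots> \<le> real B ^ (n - 1) * (real T)\<^sup>2 / 2"
      using B T c Q0 \<kappa> s by (intro divide_right_mono mult_mono power_mono) (auto simp: X_eq)
    also note card
    finally show ?thesis .
  qed
  show ?thesis
  proof (rule exI[of _ 1], intro conjI allI impI)
    fix \<gamma> :: real assume \<gamma>: "1 / 2 < \<gamma> \<and> \<gamma> < 1"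
    have "\<exists>Q\<^sub>0. \<forall>Q>Q\<^sub>0. \<forall>I\<^sub>1 I\<^sub>2. interval_with d1 (c\<^sub>8 * Q powr (- \<gamma>)) I\<^sub>1 \<longrightarrow>
       interval_with d2 (c\<^sub>8 * Q powr (- \<gamma>)) I\<^sub>2 \<longrightarrow>
       c13 * Q powr (real n + 1) * measure lebesgue (I\<^sub>1 \<times> I\<^sub>2) < real (card (algebraic_points n Q \<inter> I\<^sub>1 \<times> I\<^sub>2))"
      if "c\<^sub>8 > 1" for c\<^sub>8
    proof -
      have c8: "c\<^sub>8 > 0" using that by simp
      have "0 < \<gamma>" "\<gamma> < 1" "D / 2 > 0" using \<gamma> D by simp_all
      from eventually_scales[OF this(1,2) c \<kappa> c8 this(3)]
      show ?thesis unfolding eventually_at_top_dense using main[OF _ c8] by blast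
    qed
    then show "\<exists>c\<^sub>1\<^sub>3>0. \<forall>c\<^sub>8>1. \<exists>Q\<^sub>0. \<forall>Q>Q\<^sub>0. \<forall>I\<^sub>1 I\<^sub>2.
       interval_with (fst d) (c\<^sub>8 * Q powr (- \<gamma>)) I\<^sub>1 \<longrightarrow>
       interval_with (snd d) (c\<^sub>8 * Q powr (- \<gamma>)) I\<^sub>2 \<longrightarrow>
       special d \<gamma> Q (1 / 2) (1 / 2) (I\<^sub>1 \<times> I\<^sub>2) \<longrightarrow>
       real (card (algebraic_points n Q \<inter> I\<^sub>1 \<times> I\<^sub>2)) >
         c\<^sub>1\<^sub>3 * Q powr (real n + 1) * measure lebesgue (I\<^sub>1 \<times> I\<^sub>2)"
      using c13 unfolding d1_def d2_def by meson
  qed simp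
qed

end
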